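(* Let $H\subset X=[0,1]^2$ be an open convex set which is an interior hole, that is, $\overline H\subset(0,1)\times(0,1)$. Then $\dim_{\mathrm H}\mathcal J(H)>0$, where $\mathcal J(H)$ is the survivor set of $H$ for the baker's map and $\dim_{\mathrm H}$ is Hausdorff dimension.
   Context: Let $X=[0,1]^2$. The baker's map is $B(x,y)=(2x,\frac y2)$ if $0\le x<\frac12$ and $B(x,y)=(2x-1,\frac{y+1}2)$ if $\frac12\le x<1$. For a bi-infinite sequence $u=(x_n)_{n\in\mathbb Z}\in\{0,1\}^{\mathbb Z}$, written $\dots x_{-1}x_0\cdot x_1x_2\dots$, put $\pi(u)=\left(\sum_{n\ge1}x_n2^{-n},\ \sum_{n\ge0}x_{-n}2^{-n-1}\right)$. The map $\pi$ conjugates the left shift $\sigma$ and $B$; points and sequences are used interchangeably, so the $B$-orbit of the point $\pi(u)$ is $(\pi(\sigma^n u))_{n\in\mathbb Z}$. For $H\subset X$ the survivor set is $\mathcal J(H)=\{(x,y)\in X: B^n(x,y)\notin H \text{ for all } n\in\mathbb Z\}$, i.e. $\mathcal J(H)=\{\pi(u): \pi(\sigma^nu)\notin H\ \text{for all } n\in\mathbb Z\}$. *)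

theory Defs
  imports "HOL-Analysis.Analysis"
begin

section \<open>The baker's map and its symbolic coding\<close>

definition unit_square :: "(real \<times> real) set" where
  "unit_square = {0..1} \<times> {0..1}"

text \<open>Intended for \<open>0 \<le> x < 1\<close>; the value on the edge \<open>x = 1\<close> is irrelevant.\<close>

definition baker :: "real \<times> real \<Rightarrow> real \<times> real" where
  "baker = (\<lambda>(x, y). if x < 1/2 then (2 * x, y / 2) else (2 * x - 1, (y + 1) / 2))"

text \<open>Elements of \<open>{0,1}\<^sup>\<int>\<close> are functions \<^typ>\<open>int \<Rightarrow> bool\<close>; the digit at place \<open>n\<close> is
  \<open>of_bool (u n)\<close>.\<close>

text \<open>\<open>shift n\<close> is the \<open>n\<close>-th power of the left shift, for every integer \<open>n\<close>.\<close>

definition shift :: "int \<Rightarrow> (int \<Rightarrow> bool) \<Rightarrow> int \<Rightarrow> bool" where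
  "shift n u = (\<lambda>m. u (m + n))"

text \<open>The first sum is the series over \<open>n \<ge> 1\<close> of \<open>u n / 2 ^ n\<close>, reindexed to start at \<open>0\<close>.\<close>

definition coding :: "(int \<Rightarrow> bool) \<Rightarrow> real \<times> real" where
  "coding u = (\<Sum>n. of_bool (u (int n + 1)) / 2 ^ (n + 1), \<Sum>n. of_bool (u (- int n)) / 2 ^ (n + 1))"

text \<open>Dyadic points have several codes, and the baker's map is not invertible on the closed square;
  the two-sided orbit is therefore taken along a code, and a point survives if the orbit of one of
  its codes misses \<open>H\<close>. The lemma \<open>baker_coding\<close> below identifies these orbits with orbits of the
  baker's map.\<close>

definition survivor_set :: "(real \<times> real) set \<Rightarrow> (real \<times> real) set" where
  "survivor_set H = {coding u | u. \<forall>n. coding (shift n u) \<notin> H}"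

definition interior_hole :: "(real \<times> real) set \<Rightarrow> bool" where
  "interior_hole H \<longleftrightarrow> closure H \<subseteq> {0<..<1} \<times> {0<..<1}"

lemma shift_0: "shift 0 u = u"
  by (simp add: shift_def)

lemma shift_shift: "shift m (shift n u) = shift (m + n) u"
  by (simp add: shift_def add.assoc)

lemma summable_digits:
  "summable (\<lambda>n. of_bool (P n) / 2 ^ (n + 1) :: real)"
proof (rule summable_comparison_test')
  show "summable (\<lambda>n. (1/2 :: real) ^ n)" by (rule summable_geometric) simp
  show "norm (of_bool (P n) / 2 ^ (n + 1) :: real) \<le> (1/2) ^ n" for n
    by (cases "P n") (simp_all add: power_one_over field_simps)
qed

lemma suminf_digits_bounds:
  "(\<Sum>n. of_bool (P n) / 2 ^ (n + 1) :: real) \<in> {0..1}"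
proof -
  have s: "(\<lambda>n. 1 / 2 ^ (n + 1) :: real) sums 1"
    using power_half_series by (simp add: power_one_over)
  have "(\<Sum>n. of_bool (P n) / 2 ^ (n + 1) :: real) \<le> (\<Sum>n. 1 / 2 ^ (n + 1))"
    by (rule suminf_le[OF _ summable_digits sums_summable[OF s]])
      (simp add: divide_right_mono)
  moreover have "0 \<le> (\<Sum>n. of_bool (P n) / 2 ^ (n + 1) :: real)"
    by (rule suminf_nonneg[OF summable_digits]) simp
  ultimately show ?thesis using sums_unique[OF s] by simp
qed

lemma suminf_digits_less_1:
  assumes "\<not> P k"
  shows "(\<Sum>n. of_bool (P n) / 2 ^ (n + 1) :: real) < 1"
proof -
  have s: "(\<lambda>n. 1 / 2 ^ (n + 1) :: real) sums 1"
    using power_half_series by (simp add: power_one_over)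
  have "0 < (\<Sum>n. 1 / 2 ^ (n + 1) - of_bool (P n) / 2 ^ (n + 1) :: real)"
    by (rule suminf_pos2[where i = k, OF summable_diff[OF sums_summable[OF s] summable_digits]])
      (use assms in \<open>simp_all add: divide_right_mono\<close>)
  also have "\<dots> = 1 - (\<Sum>n. of_bool (P n) / 2 ^ (n + 1) :: real)"
    using suminf_diff[OF sums_summable[OF s] summable_digits[of P]] sums_unique[OF s] by simp
  finally show ?thesis by simp
qed

lemma suminf_digits_rec:
  "(\<Sum>n. of_bool (P n) / 2 ^ (n + 1) :: real) =
    of_bool (P 0) / 2 + (\<Sum>n. of_bool (P (Suc n)) / 2 ^ (n + 1)) / 2"
proof -
  have "(\<Sum>n. of_bool (P n) / 2 ^ (n + 1) :: real) =
      of_bool (P 0) / 2 + (\<Sum>n. of_bool (P (Suc n)) / 2 ^ (Suc n + 1))"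
    using suminf_split_head[OF summable_digits[of P]] by simp
  also have "(\<Sum>n. of_bool (P (Suc n)) / 2 ^ (Suc n + 1) :: real) =
      (\<Sum>n. of_bool (P (Suc n)) / 2 ^ (n + 1)) / 2"
    using suminf_divide[OF summable_digits[of "\<lambda>n. P (Suc n)"], of 2]
    by (simp add: mult.commute)
  finally show ?thesis .
qed

lemma coding_in_unit_square: "coding u \<in> unit_square"
  using suminf_digits_bounds[of "\<lambda>n. u (int n + 1)"] suminf_digits_bounds[of "\<lambda>n. u (- int n)"]
  by (simp add: coding_def unit_square_def)

text \<open>The hypothesis excludes codes whose digits from place \<open>2\<close> onwards are all \<open>1\<close>.\<close>

lemma baker_coding:
  assumes "\<exists>n\<ge>2. \<not> u n"
  shows "baker (coding u) = coding (shift 1 u)"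
proof -
  define a where "a = (\<Sum>n. of_bool (u (int n + 2)) / 2 ^ (n + 1) :: real)"
  define y where "y = (\<Sum>n. of_bool (u (- int n)) / 2 ^ (n + 1) :: real)"
  obtain n where n: "n \<ge> 2" "\<not> u n" using assms by blast
  have "\<not> u (int (nat (n - 2)) + 2)" using n by simp
  then have a1: "a < 1" unfolding a_def by (rule suminf_digits_less_1)
  have a0: "0 \<le> a" unfolding a_def using suminf_digits_bounds[of "\<lambda>n. u (int n + 2)"] by simp
  have x: "(\<Sum>n. of_bool (u (int n + 1)) / 2 ^ (n + 1) :: real) = of_bool (u 1) / 2 + a / 2"
    using suminf_digits_rec[of "\<lambda>n. u (int n + 1)"] by (simp add: a_def add.commute)
  have y': "(\<Sum>n. of_bool (u (- int n + 1)) / 2 ^ (n + 1) :: real) = of_bool (u 1) / 2 + y / 2"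
    using suminf_digits_rec[of "\<lambda>n. u (- int n + 1)"] by (simp add: y_def)
  have "coding u = (of_bool (u 1) / 2 + a / 2, y)"
    by (simp only: coding_def x y_def)
  moreover have "coding (shift 1 u) = (a, of_bool (u 1) / 2 + y / 2)"
    by (simp only: coding_def shift_def y' a_def add.assoc one_add_one)
  ultimately show ?thesis
    using a0 a1 by (cases "u 1") (simp_all add: baker_def field_simps)
qed


section \<open>Hausdorff measure and dimension\<close>

text \<open>Convention: \<open>diam U ^ 0\<close> is \<open>1\<close> for nonempty \<open>U\<close> (whereas \<open>0 powr 0 = 0\<close>), and
  the empty set always contributes \<open>0\<close>.\<close>

definition diam_power :: "real \<Rightarrow> 'a::metric_space set \<Rightarrow> ennreal" where
  "diam_power s U =
    (if U = {} then 0 else if s = 0 then 1 else ennreal (diameter U powr s))"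

text \<open>Boundedness is required explicitly because \<^const>\<open>diameter\<close> is real-valued and hence
  unspecified on unbounded sets.\<close>

definition hausdorff_premeasure :: "real \<Rightarrow> real \<Rightarrow> 'a::metric_space set \<Rightarrow> ennreal" where
  "hausdorff_premeasure s \<delta> A =
    Inf {(\<Sum>i. diam_power s (U i)) | U :: nat \<Rightarrow> 'a set.
      A \<subseteq> (\<Union>i. U i) \<and> (\<forall>i. bounded (U i) \<and> diameter (U i) \<le> \<delta>)}"

definition hausdorff_measure :: "real \<Rightarrow> 'a::metric_space set \<Rightarrow> ennreal" where
  "hausdorff_measure s A = (SUP \<delta>\<in>{0<..}. hausdorff_premeasure s \<delta> A)"

definition hausdorff_dim :: "'a::metric_space set \<Rightarrow> ennreal" where
  "hausdorff_dim A = Inf {ennreal s | s. 0 \<le> s \<and> hausdorff_measure s A = 0}"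

end

theory Submission
  imports Defs
begin

text \<open>Stretch an arbitrary sequence by repeating each letter \<open>2k\<close> times. At every place, one of the
  two half-sequences starts with \<open>k\<close> equal letters, so the orbit stays within \<open>2\<^sup>-\<^sup>k\<close> of the
  boundary of the square and misses \<open>H\<close> for large \<open>k\<close>. The abscissae of the points coded in this way
  fill a Cantor set with two digits in base \<open>2\<^sup>2\<^sup>k\<close>, on which reading the unstretched sequence
  as a binary expansion is Hoelder continuous of exponent \<open>1/(2k)\<close> and onto \<open>[0,1)\<close>; hence the dimension
  is at least \<open>1/(2k)\<close>.\<close>

section \<open>One-sided binary expansions\<close>

definition binary_sum :: "(nat \<Rightarrow> bool) \<Rightarrow> real" where
  "binary_sum P = (\<Sum>n. of_bool (P n) / 2 ^ (n + 1))"

lemma binary_sum_bounds: "0 \<le> binary_sum P" "binary_sum P \<le> 1"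
  using suminf_digits_bounds[of P] by (simp_all add: binary_sum_def)

lemma binary_sum_rec: "binary_sum P = of_bool (P 0) / 2 + binary_sum (\<lambda>n. P (Suc n)) / 2"
  unfolding binary_sum_def by (rule suminf_digits_rec)

text \<open>An equality rather than a bound, because it serves twice: for the upper estimate
  \<open>binary_sum_agree_le\<close>, and for the lower estimate of a gap in
  \<open>binary_sum_stretch_Hoelder\<close>.\<close>

lemma binary_sum_diff_agree:
  assumes "\<And>n. n < k \<Longrightarrow> P n = Q n"
  shows "binary_sum P - binary_sum Q =
    (binary_sum (\<lambda>n. P (n + k)) - binary_sum (\<lambda>n. Q (n + k))) / 2 ^ k"
  using assms
proof (induction k arbitrary: P Q)
  case (Suc k)
  have "binary_sum P - binary_sum Q =
      (binary_sum (\<lambda>n. P (Suc n)) - binary_sum (\<lambda>n. Q (Suc n))) / 2"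
    using binary_sum_rec[of P] binary_sum_rec[of Q] Suc.prems[of 0] by (simp add: diff_divide_distrib)
  also have "binary_sum (\<lambda>n. P (Suc n)) - binary_sum (\<lambda>n. Q (Suc n)) =
      (binary_sum (\<lambda>n. P (Suc (n + k))) - binary_sum (\<lambda>n. Q (Suc (n + k)))) / 2 ^ k"
    by (rule Suc.IH) (simp add: Suc.prems)
  finally show ?case by (simp add: mult.commute)
qed simp

lemma binary_sum_agree_le:
  assumes "\<And>n. n < k \<Longrightarrow> P n = Q n"
  shows "\<bar>binary_sum P - binary_sum Q\<bar> \<le> 1 / 2 ^ k"
proof -
  have "\<bar>binary_sum (\<lambda>n. P (n + k)) - binary_sum (\<lambda>n. Q (n + k))\<bar> \<le> 1"
    using binary_sum_bounds[of "\<lambda>n. P (n + k)"] binary_sum_bounds[of "\<lambda>n. Q (n + k)"] by linarith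
  then show ?thesis
    using binary_sum_diff_agree[of k P Q] assms by (simp add: divide_right_mono)
qed

lemma binary_sum_const: "binary_sum (\<lambda>_. b) = of_bool b"
  using binary_sum_rec[of "\<lambda>_. b"] by (cases b) simp_all

text \<open>The partial sums over the binary digits of \<open>t\<close> are the truncations
  \<open>\<lfloor>2 ^ k * t\<rfloor> / 2 ^ k\<close>, which converge to \<open>t\<close>. The bound
  \<open>t < 1\<close> makes the truncation at \<open>k = 0\<close> vanish.\<close>

lemma binary_sum_onto:
  assumes "0 \<le> t" "t < 1"
  shows "\<exists>P. binary_sum P = t"
proof
  let ?P = "\<lambda>n. odd \<lfloor>2 ^ Suc n * t\<rfloor>"
  have partial: "(\<Sum>n<k. of_bool (?P n) / 2 ^ (n + 1)) = real_of_int \<lfloor>2 ^ k * t\<rfloor> / 2 ^ k" for k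
  proof (induction k)
    case 0
    have "\<lfloor>t\<rfloor> = 0" using assms by (simp add: floor_eq_iff)
    then show ?case by simp
  next
    case (Suc k)
    define a where "a = \<lfloor>2 ^ Suc k * t\<rfloor>"
    \<comment> \<open>Halving and rounding down deletes the last binary digit, which is the parity
      of \<open>a\<close>.\<close>
    have "a div 2 = \<lfloor>2 ^ k * t\<rfloor>"
      unfolding a_def using floor_divide_real_eq_div[of 2 "2 ^ Suc k * t"] by simp
    moreover have "a = 2 * (a div 2) + of_bool (odd a)"
      by (simp add: mod_2_eq_odd[symmetric])
    ultimately have "real_of_int a = real_of_int (2 * \<lfloor>2 ^ k * t\<rfloor> + of_bool (odd a))"
      by simp
    then have "real_of_int a = 2 * real_of_int \<lfloor>2 ^ k * t\<rfloor> + of_bool (odd a)"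
      by (simp del: of_bool_odd_eq_mod_2)
    then show ?case using Suc unfolding sum.lessThan_Suc a_def[symmetric] by (simp add: field_simps)
  qed
  have "(\<lambda>k. real_of_int \<lfloor>2 ^ k * t\<rfloor> / 2 ^ k) \<longlonglongrightarrow> t"
  proof (rule tendsto_sandwich)
    show "\<forall>\<^sub>F k in sequentially. t - (1/2) ^ k \<le> real_of_int \<lfloor>2 ^ k * t\<rfloor> / 2 ^ k"
    proof (intro always_eventually allI)
      fix k
      have "2 ^ k * t - 1 \<le> real_of_int \<lfloor>2 ^ k * t\<rfloor>" by linarith
      then have "(2 ^ k * t - 1) / 2 ^ k \<le> real_of_int \<lfloor>2 ^ k * t\<rfloor> / 2 ^ k"
        by (rule divide_right_mono) simp
      then show "t - (1/2) ^ k \<le> real_of_int \<lfloor>2 ^ k * t\<rfloor> / 2 ^ k"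
        by (simp add: power_one_over diff_divide_distrib)
    qed
    show "\<forall>\<^sub>F k in sequentially. real_of_int \<lfloor>2 ^ k * t\<rfloor> / 2 ^ k \<le> t"
    proof (intro always_eventually allI)
      fix k
      have "real_of_int \<lfloor>2 ^ k * t\<rfloor> \<le> 2 ^ k * t" by linarith
      then show "real_of_int \<lfloor>2 ^ k * t\<rfloor> / 2 ^ k \<le> t" by (simp add: field_simps)
    qed
    have "(\<lambda>k. t - (1/2) ^ k) \<longlonglongrightarrow> t - 0"
      by (intro tendsto_diff tendsto_const LIMSEQ_power_zero) simp
    then show "(\<lambda>k. t - (1/2) ^ k) \<longlonglongrightarrow> t" by simp
  qed simp
  then have "(\<lambda>n. of_bool (?P n) / 2 ^ (n + 1)) sums t"
    unfolding sums_def partial .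
  then show "binary_sum ?P = t" unfolding binary_sum_def by (rule sums_unique[symmetric])
qed

section \<open>Dimension bounds from Hoelder maps\<close>

text \<open>A cover of \<open>A\<close> by sets of diameter \<open>d\<close> turns into a cover of
  \<open>[0,1)\<close> by intervals of length \<open>2 * C * d powr s\<close>. Lebesgue measure 1
  then keeps the sums of \<open>d powr t\<close> away from 0 for every \<open>t < s\<close>. Since
  \<open>0 powr s = 0\<close>, the Hoelder bound makes \<open>\<phi>\<close> a function of
  \<open>p\<close>; the index type avoids inverting \<open>p\<close>.\<close>

lemma hausdorff_dim_ge_of_Hoelder:
  fixes p :: "'i \<Rightarrow> 'a::metric_space" and \<phi> :: "'i \<Rightarrow> real"
  assumes "range p \<subseteq> A" and onto: "{0..<1} \<subseteq> range \<phi>" and "s > 0" and "C > 0"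
    and Hoelder: "\<And>v w. \<bar>\<phi> v - \<phi> w\<bar> \<le> C * dist (p v) (p w) powr s"
  shows "ennreal s \<le> hausdorff_dim A"
  unfolding hausdorff_dim_def
proof (rule Inf_greatest, clarify)
  fix t :: real
  assume t: "0 \<le> t" "hausdorff_measure t A = 0"
  show "ennreal s \<le> ennreal t"
  proof (rule ccontr)
    assume "\<not> ennreal s \<le> ennreal t"
    then have "t < s" using t ennreal_leI[of s t] by linarith
    have piece: "\<exists>J \<in> sets lborel. {\<phi> w | w. p w \<in> U} \<subseteq> J \<and>
        emeasure lborel J \<le> ennreal (2 * C) * diam_power t U"
      if U: "bounded U" "diameter U \<le> 1" for U
    proof (cases "\<exists>v. p v \<in> U")
      case True
      then obtain v where v: "p v \<in> U" by blast
      let ?r = "C * diameter U powr s"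
      let ?J = "{\<phi> v - ?r .. \<phi> v + ?r}"
      have "{\<phi> w | w. p w \<in> U} \<subseteq> ?J"
      proof clarify
        fix w assume "p w \<in> U"
        then have "dist (p v) (p w) \<le> diameter U" using diameter_bounded_bound U v by blast
        then have "dist (p v) (p w) powr s \<le> diameter U powr s"
          using \<open>s > 0\<close> by (intro powr_mono2) auto
        then have "\<bar>\<phi> v - \<phi> w\<bar> \<le> ?r"
          using Hoelder[of v w] \<open>C > 0\<close> by (meson mult_left_mono order_trans less_imp_le)
        then show "\<phi> w \<in> ?J" by (simp add: abs_le_iff)
      qed
      moreover have "emeasure lborel ?J \<le> ennreal (2 * C) * diam_power t U"
      proof -
        have d: "0 \<le> diameter U" by (rule diameter_ge_0[OF U(1)])
        \<comment> \<open>For diameters at most 1 the smaller exponent gives the larger power. The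
          case \<open>t = 0\<close> is separate because \<open>diam_power\<close> then counts 1 even
          for a singleton, whereas \<open>0 powr 0 = 0\<close>.\<close>
        have le: "diameter U powr s \<le> (if t = 0 then 1 else diameter U powr t)"
        proof (cases "t = 0")
          case True
          then show ?thesis using d U \<open>s > 0\<close> powr_le1[of s "diameter U"] by simp
        next
          case False
          then show ?thesis using d U \<open>t < s\<close> powr_mono'[of t s "diameter U"] by simp
        qed
        have "emeasure lborel ?J = ennreal (2 * C * diameter U powr s)"
          using \<open>C > 0\<close> by (simp add: algebra_simps)
        also have "\<dots> \<le> ennreal (2 * C * (if t = 0 then 1 else diameter U powr t))"
          using le \<open>C > 0\<close> by (intro ennreal_leI mult_left_mono) auto
        also have "\<dots> = ennreal (2 * C) * diam_power t U"
          using v \<open>C > 0\<close> by (auto simp: diam_power_def ennreal_mult)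
        finally show ?thesis .
      qed
      ultimately show ?thesis by (intro bexI[of _ ?J]) auto
    next
      case False
      then show ?thesis by (intro bexI[of _ "{}"]) auto
    qed
    have cover: "ennreal (1 / (2 * C)) \<le> (\<Sum>i. diam_power t (U i))"
      if U: "A \<subseteq> (\<Union>i. U i)" "\<forall>i. bounded (U i) \<and> diameter (U i) \<le> 1" for U :: "nat \<Rightarrow> 'a set"
    proof -
      have "\<exists>J. \<forall>i. J i \<in> sets lborel \<and> {\<phi> w | w. p w \<in> U i} \<subseteq> J i \<and>
          emeasure lborel (J i) \<le> ennreal (2 * C) * diam_power t (U i)"
        using piece U(2) by (intro choice allI) (meson bexE)
      then obtain J where J: "\<And>i. J i \<in> sets lborel" "\<And>i. {\<phi> w | w. p w \<in> U i} \<subseteq> J i"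
          "\<And>i. emeasure lborel (J i) \<le> ennreal (2 * C) * diam_power t (U i)"
        by blast
      have sub: "{0..<1} \<subseteq> (\<Union>i. J i)"
      proof
        fix y :: real assume "y \<in> {0..<1}"
        then obtain w where w: "y = \<phi> w" using onto by blast
        obtain i where "p w \<in> U i" using assms(1) U(1) by blast
        then show "y \<in> (\<Union>i. J i)" using J(2)[of i] w by blast
      qed
      have "1 = emeasure lborel {0..<1::real}" by simp
      also have "\<dots> \<le> emeasure lborel (\<Union>i. J i)"
        using J(1) sub by (intro emeasure_mono) auto
      also have "\<dots> \<le> (\<Sum>i. emeasure lborel (J i))"
        using J(1) by (intro emeasure_subadditive_countably) auto
      also have "\<dots> \<le> (\<Sum>i. ennreal (2 * C) * diam_power t (U i))"
        using J(3) by (intro suminf_le) auto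
      also have "\<dots> = ennreal (2 * C) * (\<Sum>i. diam_power t (U i))" by simp
      finally have "ennreal (1 / (2 * C)) * 1 \<le>
          ennreal (1 / (2 * C)) * (ennreal (2 * C) * (\<Sum>i. diam_power t (U i)))"
        by (intro mult_left_mono) auto
      also have "\<dots> = (\<Sum>i. diam_power t (U i))"
        using \<open>C > 0\<close> by (simp add: mult.assoc[symmetric] ennreal_mult[symmetric])
      finally show ?thesis by simp
    qed
    \<comment> \<open>The single scale 1 suffices, as the measure is a supremum over all
      scales.\<close>
    have "ennreal (1 / (2 * C)) \<le> hausdorff_premeasure t 1 A"
      unfolding hausdorff_premeasure_def using cover by (intro Inf_greatest) blast
    also have "\<dots> \<le> hausdorff_measure t A"
      unfolding hausdorff_measure_def by (intro SUP_upper) simp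
    finally show False using t(2) \<open>C > 0\<close> by simp
  qed
qed

section \<open>Stretched sequences and the hole\<close>

text \<open>The offset \<open>m - 1\<close> starts a block at place 1, where the abscissa starts
  reading. As \<open>div\<close> rounds down, blocks at negative places also have full length
  \<open>l\<close>.\<close>

definition stretch :: "nat \<Rightarrow> (int \<Rightarrow> bool) \<Rightarrow> int \<Rightarrow> bool" where
  "stretch l v = (\<lambda>m. v ((m - 1) div int l))"

lemma coding_binary_sum:
  "coding u = (binary_sum (\<lambda>n. u (int n + 1)), binary_sum (\<lambda>n. u (- int n)))"
  by (simp only: coding_def binary_sum_def)

text \<open>Cut the sequence after place \<open>n\<close>. The block containing place
  \<open>n + 1\<close> has \<open>2 * k\<close> places, so at least \<open>k\<close> of them lie on
  one side of the cut. The coordinate read on that side starts with \<open>k\<close> letters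
  \<open>b\<close> and is close to the value of the constant expansion, which is an edge coordinate
  0 or 1.\<close>

lemma coding_shift_stretch_near_boundary:
  assumes "coding (shift n (stretch (2 * k) v)) = (x, y)" and "k > 0"
  obtains b where "\<bar>x - of_bool b\<bar> \<le> 1 / 2 ^ k \<or> \<bar>y - of_bool b\<bar> \<le> 1 / 2 ^ k"
proof -
  define l where "l = 2 * int k"
  define q where "q = n div l"
  define b where "b = v q"
  have l: "l > 0" using assms(2) by (simp add: l_def)
  have n: "n = l * q + n mod l" by (simp add: q_def)
  have mod: "0 \<le> n mod l" "n mod l < l" using l by simp_all
  have digit: "stretch (2 * k) v m = b" if "l * q \<le> m - 1" "m - 1 < l * q + l" for m
  proof -
    have "(m - 1) div l = q" using that by (intro int_div_pos_eq[of _ l q "m - 1 - l * q"]) auto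
    then show ?thesis by (simp add: stretch_def b_def l_def)
  qed
  have "\<bar>x - of_bool b\<bar> \<le> 1 / 2 ^ k \<or> \<bar>y - of_bool b\<bar> \<le> 1 / 2 ^ k"
  \<comment> \<open>The block has \<open>n mod l\<close> places up to the cut and
    \<open>l - n mod l\<close> after it.\<close>
  proof (cases "n mod l \<le> int k")
    case True
    have "x = binary_sum (\<lambda>i. stretch (2 * k) v (int i + 1 + n))"
      using assms(1) by (simp add: coding_binary_sum shift_def)
    moreover have "\<bar>binary_sum (\<lambda>i. stretch (2 * k) v (int i + 1 + n)) - binary_sum (\<lambda>_. b)\<bar> \<le> 1 / 2 ^ k"
    proof (rule binary_sum_agree_le)
      fix i assume "i < k"
      with True mod n l_def show "stretch (2 * k) v (int i + 1 + n) = b"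
        by (intro digit) linarith+
    qed
    ultimately show ?thesis by (simp add: binary_sum_const)
  next
    case False
    have "y = binary_sum (\<lambda>i. stretch (2 * k) v (- int i + n))"
      using assms(1) by (simp add: coding_binary_sum shift_def)
    moreover have "\<bar>binary_sum (\<lambda>i. stretch (2 * k) v (- int i + n)) - binary_sum (\<lambda>_. b)\<bar> \<le> 1 / 2 ^ k"
    proof (rule binary_sum_agree_le)
      fix i assume "i < k"
      with False mod n l_def show "stretch (2 * k) v (- int i + n) = b"
        by (intro digit) linarith+
    qed
    ultimately show ?thesis by (simp add: binary_sum_const)
  qed
  then show ?thesis by (rule that)
qed

text \<open>Compactness of \<open>closure H\<close> in the open square yields a uniform margin
  \<open>e\<close>; the axis-parallel extreme points of each closed ball give the coordinate
  bounds.\<close>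

lemma interior_hole_away_from_boundary:
  assumes "interior_hole H"
  obtains e where "e > 0" "\<And>x y. (x, y) \<in> H \<Longrightarrow> x \<in> {e<..<1-e} \<and> y \<in> {e<..<1-e}"
proof -
  have "H \<subseteq> cbox (0, 0) (1, 1)"
    using assms closure_subset[of H] by (force simp: interior_hole_def cbox_Pair_eq)
  then have "compact (closure H)" using bounded_cbox bounded_subset compact_closure by blast
  moreover have "open ({0<..<1::real} \<times> {0<..<1::real})" by (intro open_Times) auto
  ultimately obtain e where e: "e > 0" "(\<Union>z\<in>closure H. cball z e) \<subseteq> {0<..<1} \<times> {0<..<1}"
    using compact_subset_open_imp_cball_epsilon_subset assms unfolding interior_hole_def by metis
  have "x \<in> {e<..<1-e} \<and> y \<in> {e<..<1-e}" if "(x, y) \<in> H" for x y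
  proof -
    have "cball (x, y) e \<subseteq> {0<..<1} \<times> {0<..<1}"
      using e(2) that closure_subset[of H] by blast
    moreover have "(x - e, y) \<in> cball (x, y) e" "(x + e, y) \<in> cball (x, y) e"
        "(x, y - e) \<in> cball (x, y) e" "(x, y + e) \<in> cball (x, y) e"
      using e(1) by (simp_all add: dist_Pair_Pair dist_real_def)
    ultimately show ?thesis by auto
  qed
  with e(1) show ?thesis by (rule that)
qed

lemma coding_stretch_in_survivor_set:
  assumes "interior_hole H"
  obtains k where "k > 0" "\<And>v. coding (stretch (2 * k) v) \<in> survivor_set H"
proof -
  obtain e where e: "e > 0" "\<And>x y. (x, y) \<in> H \<Longrightarrow> x \<in> {e<..<1-e} \<and> y \<in> {e<..<1-e}"
    using interior_hole_away_from_boundary[OF assms] by blast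
  obtain j where j: "(1/2) ^ j < e" using real_arch_pow_inv[of e "1/2"] e(1) by auto
  \<comment> \<open>The successor ensures \<open>k > 0\<close>.\<close>
  define k where "k = Suc j"
  have k: "1 / 2 ^ k < e" using j e(1) by (simp add: k_def power_one_over field_simps)
  have "coding (shift n (stretch (2 * k) v)) \<notin> H" for n v
  proof
    assume H: "coding (shift n (stretch (2 * k) v)) \<in> H"
    obtain x y where xy: "coding (shift n (stretch (2 * k) v)) = (x, y)" by fastforce
    have "k > 0" by (simp add: k_def)
    then obtain b where "\<bar>x - of_bool b\<bar> \<le> 1 / 2 ^ k \<or> \<bar>y - of_bool b\<bar> \<le> 1 / 2 ^ k"
      using coding_shift_stretch_near_boundary[OF xy] by blast
    then show False using e(2)[of x y] H k unfolding xy by (cases b) auto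
  qed
  then show ?thesis by (intro that[of k]) (auto simp: k_def survivor_set_def)
qed

section \<open>Hoelder estimate and conclusion\<close>

text \<open>If \<open>P\<close> and \<open>Q\<close> first differ at \<open>j\<close>, their sums
  differ by at most \<open>1 / 2 ^ j\<close>, while the stretched sums differ by at least
  \<open>(1 / 2) / 2 ^ (j * l)\<close>; an \<open>l\<close>-th root compares the two. Repeating
  letters (\<open>l \<ge> 2\<close>) excludes pairs like 0111... and 1000..., whose gap is
  0.\<close>

lemma binary_sum_stretch_Hoelder:
  assumes "l \<ge> 2"
  shows "\<bar>binary_sum P - binary_sum Q\<bar> \<le>
    2 * \<bar>binary_sum (\<lambda>n. P (n div l)) - binary_sum (\<lambda>n. Q (n div l))\<bar> powr (1 / real l)"
proof (cases "P = Q")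
  case False
  define j where "j = (LEAST j. P j \<noteq> Q j)"
  have "\<exists>j. P j \<noteq> Q j" using False by (simp add: fun_eq_iff)
  then have j: "P j \<noteq> Q j" unfolding j_def by (rule LeastI_ex)
  have agree: "P i = Q i" if "i < j" for i
    using not_less_Least[of i "\<lambda>j. P j \<noteq> Q j"] that by (simp add: j_def)
  define D where "D = \<bar>binary_sum (\<lambda>n. P (n div l)) - binary_sum (\<lambda>n. Q (n div l))\<bar>"
  \<comment> \<open>The tail from place \<open>j * l\<close> starts with at least two copies of
    \<open>R j\<close>. Two such tails with different letters are therefore at least
    \<open>1 / 2\<close> apart.\<close>
  have two: "\<bar>binary_sum (\<lambda>n. R ((n + j * l) div l)) - of_bool (R j)\<bar> \<le> 1 / 4" for R
  proof -
    have "\<bar>binary_sum (\<lambda>n. R ((n + j * l) div l)) - binary_sum (\<lambda>_. R j)\<bar> \<le> 1 / 2 ^ 2"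
      by (rule binary_sum_agree_le) (use assms in simp)
    then show ?thesis by (simp add: binary_sum_const)
  qed
  define E where "E = binary_sum (\<lambda>n. P ((n + j * l) div l)) - binary_sum (\<lambda>n. Q ((n + j * l) div l))"
  have "binary_sum (\<lambda>n. P (n div l)) - binary_sum (\<lambda>n. Q (n div l)) = E / 2 ^ (j * l)"
    unfolding E_def
    by (rule binary_sum_diff_agree) (use assms in \<open>simp add: agree less_mult_imp_div_less\<close>)
  then have "D = \<bar>E\<bar> / 2 ^ (j * l)" by (simp add: D_def)
  moreover have "1 / 2 \<le> \<bar>E\<bar>"
  proof -
    have "\<bar>of_bool (P j) - of_bool (Q j)\<bar> = (1::real)" using j by auto
    with two[of P] two[of Q] show ?thesis unfolding E_def by linarith
  qed
  ultimately have "(1 / 2) / 2 ^ (j * l) \<le> D"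
    by (simp only:) (rule divide_right_mono, simp_all)
  \<comment> \<open>Weakening to an exponent divisible by \<open>l\<close> makes the root exact; the
    extra factor \<open>1 / 2\<close> it leaves is the source of the constant 2.\<close>
  moreover have "(1 / 2) ^ ((j + 1) * l) \<le> (1 / 2) / (2::real) ^ (j * l)"
  proof -
    have "(1 / 2 :: real) ^ ((j + 1) * l) \<le> (1 / 2) ^ (j * l + 1)"
      using assms by (intro power_decreasing) auto
    then show ?thesis by (simp add: power_one_over)
  qed
  ultimately have "((1 / 2) ^ ((j + 1) * l)) powr (1 / real l) \<le> D powr (1 / real l)"
    by (intro powr_mono2) auto
  moreover have "((1 / 2 :: real) ^ ((j + 1) * l)) powr (1 / real l) = (1 / 2) ^ (j + 1)"
    using assms by (simp add: powr_realpow[symmetric] powr_powr add_divide_distrib del: power_Suc)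
  ultimately have "1 / 2 ^ j \<le> 2 * D powr (1 / real l)" by (simp add: power_one_over)
  moreover have "\<bar>binary_sum P - binary_sum Q\<bar> \<le> 1 / 2 ^ j" by (rule binary_sum_agree_le) (rule agree)
  ultimately show ?thesis unfolding D_def by linarith
qed simp

theorem theorem2p5:
  fixes H :: "(real \<times> real) set"
  assumes "H \<subseteq> unit_square"
    and "open H"
    and "convex H"
    and "interior_hole H"
  shows "hausdorff_dim (survivor_set H) > 0"
proof -
  obtain k where k: "k > 0" "\<And>v. coding (stretch (2 * k) v) \<in> survivor_set H"
    using coding_stretch_in_survivor_set[OF assms(4)] by blast
  \<comment> \<open>Only the future of the code encodes \<open>w\<close>: \<open>nat\<close> sends
    negative numbers to 0, so the past is filled with the letter \<open>w 0\<close>.\<close>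
  define p where "p w = coding (stretch (2 * k) (\<lambda>m. w (nat m)))" for w
  have fst_p: "fst (p w) = binary_sum (\<lambda>n. w (n div (2 * k)))" for w
    by (simp add: p_def coding_binary_sum stretch_def nat_div_distrib nat_mult_distrib)
  have "ennreal (1 / real (2 * k)) \<le> hausdorff_dim (survivor_set H)"
  proof (rule hausdorff_dim_ge_of_Hoelder)
    show "range p \<subseteq> survivor_set H" using k(2) by (auto simp: p_def)
    show "{0..<1} \<subseteq> range binary_sum"
    proof
      fix t :: real assume "t \<in> {0..<1}"
      then show "t \<in> range binary_sum" using binary_sum_onto[of t] by (metis atLeastLessThan_iff rangeI)
    qed
    fix v w
    have "\<bar>binary_sum v - binary_sum w\<bar> \<le> 2 * dist (fst (p v)) (fst (p w)) powr (1 / real (2 * k))"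
      using binary_sum_stretch_Hoelder[of "2 * k" v w] k(1) by (simp only: fst_p dist_real_def)
    \<comment> \<open>Projecting to the abscissa does not increase distances.\<close>
    also have "\<dots> \<le> 2 * dist (p v) (p w) powr (1 / real (2 * k))"
      by (intro mult_left_mono powr_mono2 dist_fst_le) auto
    finally show "\<bar>binary_sum v - binary_sum w\<bar> \<le> 2 * dist (p v) (p w) powr (1 / real (2 * k))" .
  qed (use k(1) in auto)
  moreover have "0 < ennreal (1 / real (2 * k))" using k(1) by simp
  ultimately show ?thesis by (rule less_le_trans[rotated])
qed

end
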